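(* Let $G$ be a finite group with $N$ elements and let $\mathcal S_1,\dots,\mathcal S_n$ be a generic family of $n$ non-empty subsets of $G$. Define $\sigma_0,\sigma_1,\sigma_2,\dots$ by $\sum_{j\ge 0}\sigma_j t^j=\prod_{k=1}^n(1+\sharp(\mathcal S_k)t)$ (so $\sigma_j=0$ for $j>n$). Then the number of packings of $\mathcal S_1,\dots,\mathcal S_n$ in $G$ equals $$N^n\,U(N^{-1},\sigma_1,\sigma_2,\dots),$$ where $U$ is the series defined below (after specialization only finitely many terms are non-zero, and the expression is a polynomial of degree $n$ in $N$).
   Context: A packing of non-empty subsets $\mathcal S_1,\dots,\mathcal S_n$ of a group $G$ is an element $(g_1,\dots,g_n)\in G^n$ such that $g_1\mathcal S_1,\dots,g_n\mathcal S_n$ are pairwise disjoint. A family $\mathcal S_1,\dots,\mathcal S_n$ of non-empty subsets of a group $G$ with identity $e$ is generic if for every sequence $i_1,\dots,i_k$ of $k\ge 1$ distinct elements of $\{1,\dots,n\}$ and every choice of elements $g_{i_j}\in\mathcal S_{i_j}^{-1}\mathcal S_{i_j}\setminus\{e\}$ one has $g_{i_1}g_{i_2}\cdots g_{i_k}\neq e$. Integers $t_{i,j}(n)$ for $n\ge1$, $i,j\in\mathbb Z$: $t_{2,0}(1)=1$ and $t_{i,j}(1)=0$ otherwise; for $n\ge 2$, $t_{i,j}(n)=(i-2)t_{i-1,j}(n-1)+t_{i-1,j-1}(n-1)+(i-3)t_{i-2,j}(n-1)$ (these vanish unless $n+1\le i\le 2n$ and $0\le j\le 2n-i$). The formal power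 series $U\in\mathbb Z[\sigma_1,\sigma_2,\dots][[x]]$ is $$U(x,\sigma_1,\sigma_2,\dots)=1-\sum_{n=1}^\infty x^n\sum_{i=n+1}^{2n}\sigma_i\sum_{j=0}^{2n-i}t_{i,j}(n)(-\sigma_1)^j .$$ *)

theory Defs
  imports
    "HOL-Analysis.FPS_Convergence"
    "HOL-Library.Poly_Mapping"
    "HOL-Library.FuncSet"
    "HOL-Library.Disjoint_Sets"
    "HOL-Algebra.Coset"
begin

definition packings :: "('a, 'b) monoid_scheme \<Rightarrow> nat \<Rightarrow> (nat \<Rightarrow> 'a set) \<Rightarrow> (nat \<Rightarrow> 'a) set"
  where "packings G n S =
    {g \<in> {1..n} \<rightarrow>\<^sub>E carrier G. disjoint_family_on (\<lambda>i. g i <#\<^bsub>G\<^esub> S i) {1..n}}"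

definition generic_family :: "('a, 'b) monoid_scheme \<Rightarrow> nat \<Rightarrow> (nat \<Rightarrow> 'a set) \<Rightarrow> bool"
  where "generic_family G n S \<longleftrightarrow>
    (\<forall>is g. is \<noteq> [] \<and> distinct is \<and> set is \<subseteq> {1..n} \<and>
       (\<forall>i\<in>set is. g i \<in> ((set_inv\<^bsub>G\<^esub> (S i)) <#>\<^bsub>G\<^esub> S i) - {\<one>\<^bsub>G\<^esub>}) \<longrightarrow>
       foldr (\<otimes>\<^bsub>G\<^esub>) (map g is) \<one>\<^bsub>G\<^esub> \<noteq> \<one>\<^bsub>G\<^esub>)"

text \<open>The value at \<open>n = 0\<close> is a dummy; the numbers are only meaningful for \<open>n \<ge> 1\<close>.\<close>

fun t_num :: "nat \<Rightarrow> int \<Rightarrow> int \<Rightarrow> int"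
  where
    "t_num 0 i j = 0"
  | "t_num (Suc 0) i j = (if i = 2 \<and> j = 0 then 1 else 0)"
  | "t_num (Suc (Suc n)) i j =
       (i - 2) * t_num (Suc n) (i - 1) j + t_num (Suc n) (i - 1) (j - 1)
       + (i - 3) * t_num (Suc n) (i - 2) j"

text \<open>
  Integer polynomials in countably many indeterminates, as the monoid algebra over the
  exponent vectors; the ring operations are those of \<open>Poly_Mapping\<close>.
\<close>

type_synonym int_mpoly = "(nat \<Rightarrow>\<^sub>0 nat) \<Rightarrow>\<^sub>0 int"

definition indet :: "nat \<Rightarrow> int_mpoly"
  where "indet i = Poly_Mapping.single (Poly_Mapping.single i 1) 1"

definition eval_mpoly :: "(nat \<Rightarrow> 'a::comm_ring_1) \<Rightarrow> int_mpoly \<Rightarrow> 'a"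
  where "eval_mpoly s p =
    (\<Sum>m\<in>Poly_Mapping.keys p. of_int (Poly_Mapping.lookup p m) *
       (\<Prod>i\<in>Poly_Mapping.keys m. s i ^ Poly_Mapping.lookup m i))"

definition U_series :: "int_mpoly fps"
  where "U_series = 1 - Abs_fps (\<lambda>n. if n = 0 then 0 else
    (\<Sum>i=n+1..2*n. indet i *
       (\<Sum>j=0..2*n-i. of_int (t_num n (int i) (int j)) * (- indet 1) ^ j)))"

definition U_specialized :: "(nat \<Rightarrow> 'a::comm_ring_1) \<Rightarrow> 'a fps"
  where "U_specialized s = Abs_fps (\<lambda>n. eval_mpoly s (fps_nth U_series n))"

definition size_sigma :: "nat \<Rightarrow> (nat \<Rightarrow> 'a set) \<Rightarrow> nat \<Rightarrow> 'r::comm_ring_1"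
  where "size_sigma n S j = poly.coeff (\<Prod>k=1..n. [:1, of_nat (card (S k)):]) j"

end

theory Submission
  imports Defs
begin

text \<open>
  Remove a point \<open>s\<close> from one of the sets, say \<open>S k = insert s T\<close>. A packing with \<open>T\<close> in place of
  \<open>S k\<close> either is a packing of the original family or satisfies \<open>g k s = g i u\<close> for exactly one
  \<open>i \<noteq> k\<close> and \<open>u \<in> S i\<close>; in the latter case it amounts to a packing of the family of one set
  less in which \<open>S k\<close> and \<open>S i\<close> are merged into the disjoint union \<open>T \<union> s u\<^sup>-\<^sup>1 S i\<close>. Genericity
  makes this union disjoint and is inherited by the merged family, and once the set is empty its
  translation is unconstrained, which contributes a factor \<open>N\<close>. So the number of packings
  depends only on the cardinalities \<open>r\<close> of \<open>T\<close> and \<open>a i\<close> of the other sets, with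
  \<open>F(r + 1, a) = F(r, a) - (\<Sum>i. a i * F(r + a i, a without a i))\<close> and \<open>F(0, a) = N * F(a)\<close>.

  The expression \<open>N ^ n * U(1 / N, \<sigma>)\<close> obeys the same recursion. All merged families have the
  same \<open>\<sigma>\<^sub>1 = y = e\<^sub>1 + r\<close>, where \<open>e\<^sub>j\<close> are the elementary symmetric functions of the \<open>a i\<close>, and
  \<open>U\<close> is affine in \<open>\<sigma>\<^sub>2, \<sigma>\<^sub>3, \<dots>\<close>, so comparing the coefficients of \<open>e\<^sub>i\<close> leaves an
  identity between the polynomials \<open>\<Sum>j. t i j (n) * (- y) ^ j\<close> at \<open>y\<close> and \<open>y + 1\<close>. It follows from
  the recursion for \<open>t\<close>.
\<close>

subsection \<open>Evaluation of polynomials in countably many indeterminates\<close>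

text \<open>Adding single terms, rather than overwriting entries as in \<open>update_induct\<close>,
  suits additive maps; an update at a fresh key is such an addition.\<close>

lemma poly_mapping_add_single_induct [case_names zero add]:
  fixes p :: "'a \<Rightarrow>\<^sub>0 'b::comm_monoid_add"
  assumes "P 0" and step: "\<And>p m c. P p \<Longrightarrow> P (p + Poly_Mapping.single m c)"
  shows "P p"
proof (induction p rule: update_induct)
  case const
  then show ?case using assms(1) by simp
next
  case (update f m c)
  have "Poly_Mapping.update m c f = f + Poly_Mapping.single m c"
    using update.hyps
    by (intro poly_mapping_eqI)
      (auto simp: lookup_update lookup_add lookup_single when_def in_keys_iff)
  then show ?case using step[OF update.IH] by simp
qed

definition eval_monom :: "(nat \<Rightarrow> 'a::comm_ring_1) \<Rightarrow> (nat \<Rightarrow>\<^sub>0 nat) \<Rightarrow> 'a"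
  where "eval_monom s m = (\<Prod>i\<in>Poly_Mapping.keys m. s i ^ Poly_Mapping.lookup m i)"

text \<open>Indices outside the support contribute the factor 1, so monomials with different
  supports can be compared over a common index set.\<close>

lemma eval_monom_superset:
  assumes "finite K" "Poly_Mapping.keys m \<subseteq> K"
  shows "eval_monom s m = (\<Prod>i\<in>K. s i ^ Poly_Mapping.lookup m i)"
  unfolding eval_monom_def using assms
  by (intro prod.mono_neutral_left) (auto simp: in_keys_iff)

lemma eval_monom_add: "eval_monom s (m + m') = eval_monom s m * eval_monom s m'"
proof -
  let ?K = "Poly_Mapping.keys m \<union> Poly_Mapping.keys m'"
  have "Poly_Mapping.keys (m + m') \<subseteq> ?K" by (rule keys_add)
  then show ?thesis
    by (subst (1 2 3) eval_monom_superset[of ?K])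
      (auto simp: lookup_add power_add prod.distrib)
qed

lemma eval_mpoly_superset:
  assumes "finite K" "Poly_Mapping.keys p \<subseteq> K"
  shows "eval_mpoly s p = (\<Sum>m\<in>K. of_int (Poly_Mapping.lookup p m) * eval_monom s m)"
  unfolding eval_mpoly_def eval_monom_def using assms
  by (intro sum.mono_neutral_left) (auto simp: in_keys_iff)

lemma eval_mpoly_zero [simp]: "eval_mpoly s 0 = 0"
  by (simp add: eval_mpoly_def)

lemma eval_mpoly_single:
  "eval_mpoly s (Poly_Mapping.single m c) = of_int c * eval_monom s m"
  by (simp add: eval_mpoly_def eval_monom_def)

lemma eval_mpoly_add: "eval_mpoly s (p + q) = eval_mpoly s p + eval_mpoly s q"
proof -
  let ?K = "Poly_Mapping.keys p \<union> Poly_Mapping.keys q"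
  have "Poly_Mapping.keys (p + q) \<subseteq> ?K" by (rule keys_add)
  then show ?thesis
    by (subst (1 2 3) eval_mpoly_superset[of ?K])
      (auto simp: lookup_add algebra_simps sum.distrib)
qed

lemma eval_mpoly_single_mult:
  "eval_mpoly s (Poly_Mapping.single m c * q) = of_int c * eval_monom s m * eval_mpoly s q"
  by (induction q rule: poly_mapping_add_single_induct)
    (simp_all add: distrib_left eval_mpoly_add mult_single eval_mpoly_single eval_monom_add
      mult.assoc mult.left_commute)

lemma eval_mpoly_mult: "eval_mpoly s (p * q) = eval_mpoly s p * eval_mpoly s q"
  by (induction p rule: poly_mapping_add_single_induct)
    (simp_all add: distrib_right eval_mpoly_add eval_mpoly_single_mult eval_mpoly_single)

lemma eval_mpoly_of_int: "eval_mpoly s (of_int c) = of_int c"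
  by (simp flip: single_of_int add: eval_mpoly_single eval_monom_def)

lemma eval_mpoly_one: "eval_mpoly s 1 = 1"
  using eval_mpoly_of_int[of s 1] by simp

lemma eval_mpoly_indet: "eval_mpoly s (indet i) = s i"
  by (simp add: indet_def eval_mpoly_single eval_monom_def)

lemma eval_mpoly_uminus: "eval_mpoly s (- p) = - eval_mpoly s p"
  using eval_mpoly_add[of s "- p" p] by (simp add: eq_neg_iff_add_eq_0)

lemma eval_mpoly_power: "eval_mpoly s (p ^ k) = eval_mpoly s p ^ k"
  by (induction k) (simp_all add: eval_mpoly_one eval_mpoly_mult)

lemma eval_mpoly_sum: "eval_mpoly s (\<Sum>i\<in>A. f i) = (\<Sum>i\<in>A. eval_mpoly s (f i))"
  by (induction A rule: infinite_finite_induct) (simp_all add: eval_mpoly_add)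

subsection \<open>The coefficients of \<open>U\<close>\<close>

text \<open>An index pair outside the range for \<open>n\<close> has all its predecessors in the
  recursion outside the range for \<open>n - 1\<close>. This lets later sums run over convenient
  ranges.\<close>

lemma t_num_eq_0:
  assumes "i < int n + 1 \<or> 2 * int n < i \<or> j < 0 \<or> 2 * int n - i < j"
  shows "t_num n i j = 0"
  using assms
proof (induction n i j rule: t_num.induct)
  case (3 n i j)
  have 1: "t_num (Suc n) (i - 1) j = 0"
    by (rule 3) (use 3(4) in auto)
  have 2: "t_num (Suc n) (i - 1) (j - 1) = 0"
    by (rule 3) (use 3(4) in auto)
  have 3: "t_num (Suc n) (i - 2) j = 0"
    by (rule 3) (use 3(4) in auto)
  show ?case by (simp add: 1 2 3)
qed auto

text \<open>The inner polynomial of \<open>U\<close> with \<open>y\<close> in place of the first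
  variable. The bound \<open>2*n\<close> does not depend on \<open>i\<close>, so different
  \<open>i\<close> combine over one range; terms beyond \<open>2*n - i\<close> vanish.\<close>

definition t_poly :: "nat \<Rightarrow> int \<Rightarrow> 'a::comm_ring_1 \<Rightarrow> 'a"
  where "t_poly n i y = (\<Sum>j\<le>2*n. of_int (t_num n i (int j)) * (- y) ^ j)"

lemma t_poly_eq_0:
  assumes "i < int n + 1 \<or> 2 * int n < i"
  shows "t_poly n i y = 0"
  using assms by (auto simp: t_poly_def t_num_eq_0 intro!: sum.neutral)

lemma t_poly_extend:
  assumes "2 * n \<le> K"
  shows "t_poly n i y = (\<Sum>j\<le>K. of_int (t_num n i (int j)) * (- y) ^ j)"
proof -
  have "t_num n i (int j) = 0" if "2 * n < j" for j
    by (rule t_num_eq_0) (use that in linarith)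
  then show ?thesis unfolding t_poly_def using assms
    by (intro sum.mono_neutral_left) auto
qed

lemma t_poly_one: "t_poly (Suc 0) i y = (if i = 2 then 1 else 0)"
  by (simp add: t_poly_def numeral_2_eq_2)

lemma t_poly_rec:
  "t_poly (Suc (Suc n)) i y = (of_int (i - 2) - y) * t_poly (Suc n) (i - 1) y
     + of_int (i - 3) * t_poly (Suc n) (i - 2) y"
proof -
  let ?K = "Suc (2 * Suc n)"
  have t: "t_poly (Suc (Suc n)) i y = (\<Sum>j\<le>Suc ?K. of_int (t_num (Suc (Suc n)) i (int j)) * (- y) ^ j)"
    by (rule t_poly_extend) simp
  have a: "t_poly (Suc n) i' y = (\<Sum>j\<le>Suc ?K. of_int (t_num (Suc n) i' (int j)) * (- y) ^ j)" for i'
    by (rule t_poly_extend) simp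
  \<comment> \<open>Reindexing \<open>j - 1\<close> as \<open>j\<close> turns the middle term of the
    recursion into multiplication by \<open>- y\<close>; this is the boundary term at
    \<open>j = 0\<close>.\<close>
  have "t_num (Suc n) (i - 1) (- 1) = 0"
    by (rule t_num_eq_0) simp
  then have "(\<Sum>j\<le>Suc ?K. of_int (t_num (Suc n) (i - 1) (int j - 1)) * (- y) ^ j) =
     (\<Sum>j\<le>?K. of_int (t_num (Suc n) (i - 1) (int j)) * (- y) ^ Suc j)"
    by (subst sum.atMost_Suc_shift) simp
  also have "\<dots> = - y * t_poly (Suc n) (i - 1) y"
    by (subst t_poly_extend[of "Suc n" ?K]) (simp_all add: sum_distrib_left mult_ac del: sum.atMost_Suc)
  finally have b: "(\<Sum>j\<le>Suc ?K. of_int (t_num (Suc n) (i - 1) (int j - 1)) * (- y) ^ j) =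
    - y * t_poly (Suc n) (i - 1) y" .
  have "t_poly (Suc (Suc n)) i y = of_int (i - 2) * t_poly (Suc n) (i - 1) y
    + (\<Sum>j\<le>Suc ?K. of_int (t_num (Suc n) (i - 1) (int j - 1)) * (- y) ^ j)
    + of_int (i - 3) * t_poly (Suc n) (i - 2) y"
    unfolding t a sum_distrib_left t_num.simps sum.distrib[symmetric]
    by (rule sum.cong) (simp_all add: algebra_simps del: sum.atMost_Suc)
  then show ?thesis unfolding b by (simp add: algebra_simps)
qed

text \<open>A unit difference in \<open>y\<close> lowers \<open>n\<close> and \<open>i\<close> by
  one. In the inductive step the corrections at \<open>i - 2\<close> and \<open>i - 3\<close>
  recombine through the recursion at \<open>i - 1\<close>.\<close>

lemma t_poly_shift:
  "t_poly (Suc (Suc n)) i (y + 1) = t_poly (Suc (Suc n)) i y - of_int (i - 2) * t_poly (Suc n) (i - 1) y"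
proof (induction n arbitrary: i)
  case 0
  then show ?case by (simp add: t_poly_rec t_poly_one algebra_simps)
next
  case (Suc n)
  show ?case
    unfolding t_poly_rec[of "Suc n"] Suc.IH
    unfolding t_poly_rec[of n "i - 1"]
    by (simp add: algebra_simps)
qed

text \<open>In the application \<open>r + 1\<close> is the size of the set from which a point is removed.\<close>
lemma t_poly_functional_equation:
  "t_poly (Suc (Suc n)) i (y + 1) + (r + 1) * t_poly (Suc (Suc n)) (i + 1) (y + 1)
     - (t_poly (Suc (Suc n)) i y + r * t_poly (Suc (Suc n)) (i + 1) y)
   = - ((y + r * of_int (i - 1)) * t_poly (Suc n) i y)"
proof -
  \<comment> \<open>After the shift formula one copy of this polynomial is left over; expanding it
    cancels the term at \<open>i - 1\<close>.\<close>
  have "t_poly (Suc (Suc n)) (i + 1) y =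
      (of_int (i - 1) - y) * t_poly (Suc n) i y + of_int (i - 2) * t_poly (Suc n) (i - 1) y"
    using t_poly_rec[of n "i + 1" y] by simp
  then show ?thesis
    unfolding t_poly_shift by (simp add: algebra_simps)
qed

text \<open>The sum may start at 0 instead of \<open>m + 1\<close> because \<open>t_poly\<close>
  vanishes on the added indices.\<close>

definition U_coeff :: "(nat \<Rightarrow> 'a::comm_ring_1) \<Rightarrow> nat \<Rightarrow> 'a"
  where "U_coeff s m =
    (if m = 0 then 1 else - (\<Sum>i\<le>2*m. s i * t_poly m (int i) (s 1)))"

lemma fps_nth_U_specialized: "fps_nth (U_specialized s) m = U_coeff s m"
proof (cases "m = 0")
  case True
  then show ?thesis
    by (simp add: U_specialized_def U_series_def U_coeff_def eval_mpoly_one)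
next
  case False
  have *: "(\<Sum>j=0..2*m-i. of_int (t_num m (int i) (int j)) * (- s 1) ^ j)
      = t_poly m (int i) (s 1)" if "i \<in> {m+1..2*m}" for i
    unfolding t_poly_def using that
    by (intro sum.mono_neutral_left) (auto simp: t_num_eq_0)
  have "fps_nth (U_specialized s) m = - (\<Sum>i=m+1..2*m. s i *
      (\<Sum>j=0..2*m-i. of_int (t_num m (int i) (int j)) * (- s 1) ^ j))"
    using False unfolding U_specialized_def U_series_def
    by (simp add: eval_mpoly_uminus eval_mpoly_sum eval_mpoly_mult eval_mpoly_indet
        eval_mpoly_of_int eval_mpoly_power)
  also have "(\<Sum>i=m+1..2*m. s i *
      (\<Sum>j=0..2*m-i. of_int (t_num m (int i) (int j)) * (- s 1) ^ j))
     = (\<Sum>i=m+1..2*m. s i * t_poly m (int i) (s 1))"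
    by (intro sum.cong refl arg_cong[where f = "(*) _"] *)
  also have "\<dots> = (\<Sum>i\<le>2*m. s i * t_poly m (int i) (s 1))"
    by (intro sum.mono_neutral_left) (auto simp: t_poly_eq_0)
  finally show ?thesis using False by (simp add: U_coeff_def)
qed

text \<open>\<open>t_poly\<close> vanishes for \<open>i\<close> up to \<open>m\<close> and
  \<open>s\<close> beyond \<open>m\<close>. Hence a specialization with finitely many nonzero values
  truncates the series.\<close>

lemma U_coeff_eq_0:
  assumes "m \<noteq> 0" "\<And>i. i > m \<Longrightarrow> s i = 0"
  shows "U_coeff s m = 0"
proof -
  have "s i * t_poly m (int i) (s 1) = 0" for i
    using assms by (cases "i > m") (auto simp: t_poly_eq_0)
  then show ?thesis using assms(1) by (simp add: U_coeff_def del: One_nat_def)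
qed

subsection \<open>Elementary symmetric functions and the recursion for \<open>U\<close>\<close>

lemma U_coeff_extend:
  assumes "m \<noteq> 0" "2 * m \<le> K"
  shows "U_coeff s m = - (\<Sum>i\<le>K. s i * t_poly m (int i) (s 1))"
proof -
  have "(\<Sum>i\<le>2*m. s i * t_poly m (int i) (s 1)) = (\<Sum>i\<le>K. s i * t_poly m (int i) (s 1))"
    using assms(2) by (intro sum.mono_neutral_left) (auto simp: t_poly_eq_0)
  then show ?thesis using assms(1) by (simp add: U_coeff_def)
qed

text \<open>As coefficients of a product, insertion is multiplication by a linear factor and
  \<open>sum_esym_remove\<close> can be read off a derivative.\<close>

definition esym :: "('i \<Rightarrow> 'a::idom) \<Rightarrow> 'i set \<Rightarrow> nat \<Rightarrow> 'a"
  where "esym a I j = poly.coeff (\<Prod>i\<in>I. [:1, a i:]) j"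

lemma esym_0 [simp]: "esym a I 0 = 1"
  by (simp add: esym_def poly_prod flip: poly_0_coeff_0)

lemma esym_insert:
  assumes "finite I" "k \<notin> I"
  shows "esym a (insert k I) (Suc j) = esym a I (Suc j) + a k * esym a I j"
  using assms by (simp add: esym_def)

lemma esym_cong:
  assumes "\<And>i. i \<in> I \<Longrightarrow> a i = b i"
  shows "esym a I = esym b I"
  using assms by (simp add: esym_def fun_eq_iff cong: prod.cong)

lemma esym_eq_0:
  assumes "finite I" "card I < j"
  shows "esym a I j = 0"
  using assms
proof (induction I arbitrary: j rule: finite_induct)
  case empty
  then show ?case by (simp add: esym_def)
next
  case (insert k I)
  then show ?case by (cases j) (simp_all add: esym_insert)
qed

text \<open>The product rule for the generating polynomial, compared at degree
  \<open>j\<close>.\<close>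

lemma sum_esym_remove:
  "(\<Sum>i\<in>I. a i * esym a (I - {i}) j) = of_nat (Suc j) * esym a I (Suc j)"
proof -
  have "pderiv (\<Prod>i\<in>I. [:1, a i:]) = (\<Sum>i\<in>I. smult (a i) (\<Prod>l\<in>I-{i}. [:1, a l:]))"
    by (simp add: pderiv_prod pderiv_pCons)
  then have "poly.coeff (pderiv (\<Prod>i\<in>I. [:1, a i:])) j = (\<Sum>i\<in>I. a i * esym a (I - {i}) j)"
    by (simp add: coeff_sum esym_def)
  then show ?thesis by (simp add: coeff_pderiv esym_def)
qed

lemma esym_insert_upd:
  assumes "finite J" "k \<notin> J"
  shows "esym (a(k := r)) (insert k J) (Suc j) = esym a J (Suc j) + r * esym a J j"
proof -
  have "esym (a(k := r)) J = esym a J"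
    by (rule esym_cong) (use assms in auto)
  then show ?thesis by (simp add: esym_insert assms)
qed

text \<open>The part \<open>a i\<close> of the merged weight restores the removed factor, so only
  the contribution of \<open>r\<close> sees the removal of \<open>i\<close>. At \<open>j = 0\<close>
  the value does not depend on \<open>i\<close>.\<close>

lemma esym_merge:
  assumes "finite J" "k \<notin> J" "i \<in> J"
  shows "esym (a(k := r + a i)) (insert k (J - {i})) (Suc j)
    = esym a J (Suc j) + r * esym a (J - {i}) j"
  using esym_insert[of "J - {i}" i a j] assms
  by (simp add: esym_insert_upd insert_absorb algebra_simps)

text \<open>Each \<open>esym a J i\<close> enters the symmetric functions of the larger family at
  the indices \<open>i\<close> and \<open>i + 1\<close>; here its total coefficient is
  collected.\<close>

lemma U_coeff_esym_insert:
  fixes a :: "'i \<Rightarrow> 'a::idom"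
  assumes "finite J" "k \<notin> J" "m \<noteq> 0" "2 * m \<le> K"
  shows "U_coeff (esym (a(k := r)) (insert k J)) m =
    - (\<Sum>i\<le>K. esym a J i * (t_poly m (int i) (esym a J 1 + r)
        + r * t_poly m (int i + 1) (esym a J 1 + r)))"
proof -
  define c where "c i = t_poly m (int i) (esym a J 1 + r)" for i
  define s where "s = esym (a(k := r)) (insert k J)"
  have s_Suc: "s (Suc i) = esym a J (Suc i) + r * esym a J i" for i
    by (simp add: s_def esym_insert_upd assms)
  \<comment> \<open>These boundary values absorb the index shifts below.\<close>
  have c: "c 0 = 0" "c (Suc K) = 0"
    using assms by (auto simp: c_def t_poly_eq_0)
  have "s 1 = esym a J 1 + r"
    using s_Suc[of 0] by simp
  then have "U_coeff s m = - (\<Sum>i\<le>Suc K. s i * c i)"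
    using assms U_coeff_extend[of m "Suc K" s] by (simp add: c_def)
  also have "(\<Sum>i\<le>Suc K. s i * c i) = (\<Sum>i\<le>K. s (Suc i) * c (Suc i))"
    by (subst sum.atMost_Suc_shift) (simp add: c)
  also have "\<dots> = (\<Sum>i\<le>K. esym a J (Suc i) * c (Suc i)) + (\<Sum>i\<le>K. r * esym a J i * c (Suc i))"
    by (simp add: s_Suc distrib_right sum.distrib)
  also have "(\<Sum>i\<le>K. esym a J (Suc i) * c (Suc i)) = (\<Sum>i\<le>Suc K. esym a J i * c i)"
    by (subst sum.atMost_Suc_shift) (simp add: c)
  also have "\<dots> = (\<Sum>i\<le>K. esym a J i * c i)"
    by (simp add: c)
  finally show ?thesis
    unfolding s_def by (simp add: c_def sum.distrib distrib_left mult_ac add.commute)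
qed

text \<open>All merged families share the first symmetric function \<open>y\<close>, so
  \<open>t_poly m i y\<close> factors out of the sum over \<open>J\<close>, and the coefficients of
  \<open>e i\<close> agree by \<open>t_poly_functional_equation\<close>.\<close>

lemma U_coeff_esym_rec:
  fixes a :: "'i \<Rightarrow> 'a::idom"
  assumes J: "finite J" "k \<notin> J"
  shows "U_coeff (esym (a(k := r + 1)) (insert k J)) (Suc m)
      - U_coeff (esym (a(k := r)) (insert k J)) (Suc m)
    = - (\<Sum>i\<in>J. a i * U_coeff (esym (a(k := r + a i)) (insert k (J - {i}))) m)"
proof (cases m)
  \<comment> \<open>The functional equation relates levels from 1 and 2 upwards, so the first
    coefficient is checked directly.\<close>
  case 0
  have "(\<Sum>i\<in>J. a i) = esym a J 1"
    using sum_esym_remove[of a J 0] by simp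
  then show ?thesis using 0 J
    by (simp add: U_coeff_def t_poly_one numeral_2_eq_2 esym_insert_upd algebra_simps)
next
  case (Suc n)
  define e where "e = esym a J"
  define y where "y = e 1 + r"
  define K where "K = 2 * Suc m"
  define s where "s i = esym (a(k := r + a i)) (insert k (J - {i}))" for i
  have s_Suc: "s i (Suc j) = e (Suc j) + r * esym a (J - {i}) j" if "i \<in> J" for i j
    using esym_merge[OF J that] by (simp add: s_def e_def)
  have s_1: "s i 1 = y" if "i \<in> J" for i
    using s_Suc[OF that, of 0] by (simp add: y_def)
  have sum_a: "(\<Sum>i\<in>J. a i) = e 1"
    using sum_esym_remove[of a J 0] by (simp add: e_def)
  \<comment> \<open>With \<open>y = e 1 + r\<close> the factor \<open>y + r * (j - 1)\<close> of the
    functional equation is exactly \<open>e 1 + r * j\<close>.\<close>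
  have sum_s: "(\<Sum>i\<in>J. a i * s i j) = (e 1 + r * of_nat j) * e j" for j
  proof (cases j)
    case 0
    then show ?thesis by (simp add: s_def e_def sum_a[unfolded e_def])
  next
    case (Suc l)
    have "(\<Sum>i\<in>J. a i * s i j) = (\<Sum>i\<in>J. a i * e j + r * (a i * esym a (J - {i}) l))"
      by (intro sum.cong refl) (simp add: Suc s_Suc algebra_simps)
    also have "\<dots> = (\<Sum>i\<in>J. a i) * e j + r * (\<Sum>i\<in>J. a i * esym a (J - {i}) l)"
      by (simp add: sum.distrib sum_distrib_left sum_distrib_right)
    finally show ?thesis
      unfolding sum_esym_remove sum_a by (simp add: Suc e_def algebra_simps)
  qed
  have "U_coeff (esym (a(k := r + 1)) (insert k J)) (Suc m)
      - U_coeff (esym (a(k := r)) (insert k J)) (Suc m)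
    = - (\<Sum>i\<le>K. e i * (t_poly (Suc m) (int i) (y + 1) + (r + 1) * t_poly (Suc m) (int i + 1) (y + 1)
        - (t_poly (Suc m) (int i) y + r * t_poly (Suc m) (int i + 1) y)))"
    using U_coeff_esym_insert[OF J, of "Suc m" K a r]
      U_coeff_esym_insert[OF J, of "Suc m" K a "r + 1"]
    by (simp add: K_def y_def e_def sum_subtractf right_diff_distrib add.assoc)
  also have "\<dots> = (\<Sum>i\<le>K. (e 1 + r * of_nat i) * e i * t_poly m (int i) y)"
    unfolding Suc t_poly_functional_equation sum_negf[symmetric]
    by (intro sum.cong refl) (simp add: y_def algebra_simps)
  also have "\<dots> = (\<Sum>j\<le>K. \<Sum>i\<in>J. a i * s i j * t_poly m (int j) y)"
    unfolding sum_s[symmetric] sum_distrib_right ..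
  also have "\<dots> = (\<Sum>i\<in>J. \<Sum>j\<le>K. a i * s i j * t_poly m (int j) y)"
    by (rule sum.swap)
  also have "\<dots> = (\<Sum>i\<in>J. - (a i * U_coeff (s i) m))"
  proof (intro sum.cong refl)
    fix i assume "i \<in> J"
    then have "U_coeff (s i) m = - (\<Sum>j\<le>K. s i j * t_poly m (int j) y)"
      using U_coeff_extend[of m K "s i"] s_1[of i] by (simp add: Suc K_def del: sum.atMost_Suc)
    then show "(\<Sum>j\<le>K. a i * s i j * t_poly m (int j) y) = - (a i * U_coeff (s i) m)"
      by (simp add: sum_distrib_left mult.assoc)
  qed
  finally show ?thesis by (simp add: s_def sum_negf)
qed

text \<open>For nonzero \<open>x\<close> and coefficients vanishing beyond \<open>n\<close> this is
  \<open>x ^ n * U(1 / x)\<close>, written as a polynomial in \<open>x\<close>.\<close>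

definition U_value :: "'a::comm_ring_1 \<Rightarrow> nat \<Rightarrow> (nat \<Rightarrow> 'a) \<Rightarrow> 'a"
  where "U_value x n s = (\<Sum>m\<le>n. x ^ (n - m) * U_coeff s m)"

text \<open>Counterpart of the factor \<open>order G\<close> contributed by an empty set, whose
  translation is free.\<close>

lemma U_value_Suc:
  assumes "\<And>i. i > n \<Longrightarrow> s i = 0"
  shows "U_value x (Suc n) s = x * U_value x n s"
proof -
  have "U_coeff s (Suc n) = 0" by (rule U_coeff_eq_0) (use assms in auto)
  then show ?thesis
    by (simp add: U_value_def sum_distrib_left Suc_diff_le mult.assoc)
qed

lemma U_value_esym_rec:
  fixes a :: "'i \<Rightarrow> 'a::idom"
  assumes "finite J" "k \<notin> J"
  shows "U_value x (Suc n) (esym (a(k := r + 1)) (insert k J)) =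
    U_value x (Suc n) (esym (a(k := r)) (insert k J))
    - (\<Sum>i\<in>J. a i * U_value x n (esym (a(k := r + a i)) (insert k (J - {i}))))"
proof -
  let ?c = "\<lambda>r. U_coeff (esym (a(k := r)) (insert k J))"
  let ?d = "\<lambda>i. U_coeff (esym (a(k := r + a i)) (insert k (J - {i})))"
  \<comment> \<open>The constant coefficient is 1 for every \<open>s\<close> and cancels in the
    difference; the others shift by one, as merged families have one set fewer.\<close>
  have split: "U_value x (Suc n) s = x ^ Suc n + (\<Sum>m\<le>n. x ^ (n - m) * U_coeff s (Suc m))" for s
    unfolding U_value_def by (subst sum.atMost_Suc_shift) (simp add: U_coeff_def)
  have "(\<Sum>m\<le>n. x ^ (n - m) * ?c (r + 1) (Suc m)) - (\<Sum>m\<le>n. x ^ (n - m) * ?c r (Suc m))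
      = - (\<Sum>m\<le>n. \<Sum>i\<in>J. a i * (x ^ (n - m) * ?d i m))"
    unfolding sum_subtractf[symmetric] right_diff_distrib[symmetric] U_coeff_esym_rec[OF assms]
    by (simp add: sum_negf sum_distrib_left mult_ac)
  also have "(\<Sum>m\<le>n. \<Sum>i\<in>J. a i * (x ^ (n - m) * ?d i m)) =
      (\<Sum>i\<in>J. a i * (\<Sum>m\<le>n. x ^ (n - m) * ?d i m))"
    by (subst sum.swap) (simp add: sum_distrib_left)
  finally show ?thesis
    unfolding split by (simp add: U_value_def algebra_simps del: fun_upd_apply)
qed

subsection \<open>Generic families\<close>

context group
begin

definition quotients :: "'a set \<Rightarrow> 'a set"
  where "quotients T = {inv p \<otimes> q | p q. p \<in> T \<and> q \<in> T}"

definition list_mult :: "'a list \<Rightarrow> 'a"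
  where "list_mult xs = foldr (\<otimes>) xs \<one>"

lemma list_mult_simps [simp]:
  "list_mult [] = \<one>" "list_mult (x # xs) = x \<otimes> list_mult xs"
  by (simp_all add: list_mult_def)

lemma list_mult_closed [simp]: "set xs \<subseteq> carrier G \<Longrightarrow> list_mult xs \<in> carrier G"
  by (induction xs) auto

lemma list_mult_append:
  "set xs \<subseteq> carrier G \<Longrightarrow> set ys \<subseteq> carrier G \<Longrightarrow>
    list_mult (xs @ ys) = list_mult xs \<otimes> list_mult ys"
  by (induction xs) (auto simp: m_assoc)

lemma list_mult_filter_one:
  "set xs \<subseteq> carrier G \<Longrightarrow> list_mult (filter (\<lambda>x. x \<noteq> \<one>) xs) = list_mult xs"
  by (induction xs) auto

lemma quotients_subset: "T \<subseteq> carrier G \<Longrightarrow> quotients T \<subseteq> carrier G"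
  by (auto simp: quotients_def)

definition generic_on :: "'i set \<Rightarrow> ('i \<Rightarrow> 'a set) \<Rightarrow> bool"
  where "generic_on I S \<longleftrightarrow>
    (\<forall>is g. distinct is \<and> set is \<subseteq> I \<and> (\<forall>i\<in>set is. g i \<in> insert \<one> (quotients (S i))) \<and>
       list_mult (map g is) = \<one> \<longrightarrow> (\<forall>i\<in>set is. g i = \<one>))"

lemma generic_onD:
  assumes "generic_on I S" "distinct is" "set is \<subseteq> I"
    "\<And>i. i \<in> set is \<Longrightarrow> g i \<in> insert \<one> (quotients (S i))" "list_mult (map g is) = \<one>" "i \<in> set is"
  shows "g i = \<one>"
  using assms unfolding generic_on_def by blast

lemma generic_family_imp_generic_on:
  assumes "generic_family G n S" and S: "\<And>i. i \<in> {1..n} \<Longrightarrow> S i \<subseteq> carrier G"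
  shows "generic_on {1..n} S"
  unfolding generic_on_def
proof (intro allI impI ballI, elim conjE)
  fix "is" g i
  assume "distinct is" and sub: "set is \<subseteq> {1..n}"
    and g: "\<forall>i\<in>set is. g i \<in> insert \<one> (quotients (S i))"
    and 1: "list_mult (map g is) = \<one>" and i: "i \<in> set is"
  \<comment> \<open>Dropping trivial factors keeps the product, so a nonempty \<open>js\<close>
    would contradict genericity.\<close>
  define js where "js = filter (\<lambda>i. g i \<noteq> \<one>) is"
  have "quotients (S i) \<subseteq> carrier G" if "i \<in> set is" for i
    using quotients_subset[OF S] sub that by blast
  then have "set (map g is) \<subseteq> carrier G" using g by fastforce
  then have "list_mult (map g js) = \<one>"
    using 1 list_mult_filter_one[of "map g is"] by (simp add: js_def filter_map o_def)
  moreover have "g i \<in> ((set_inv (S i)) <#> S i) - {\<one>}" if "i \<in> set js" for i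
    using g that by (force simp: js_def quotients_def set_mult_def SET_INV_def)
  moreover have "distinct js" "set js \<subseteq> {1..n}"
    using \<open>distinct is\<close> sub by (auto simp: js_def)
  ultimately have "js = []"
    using assms(1) unfolding generic_family_def list_mult_def by blast
  then show "g i = \<one>" using i by (auto simp: js_def filter_empty_conv)
qed

lemma generic_on_mono:
  assumes "generic_on I S" "J \<subseteq> I" "\<And>i. i \<in> J \<Longrightarrow> T i \<subseteq> S i"
  shows "generic_on J T"
  unfolding generic_on_def
proof (intro allI impI ballI, elim conjE)
  fix "is" g i
  assume H: "distinct is" "set is \<subseteq> J" "\<forall>i\<in>set is. g i \<in> insert \<one> (quotients (T i))"
    "list_mult (map g is) = \<one>" "i \<in> set is"
  have "g i \<in> insert \<one> (quotients (S i))" if "i \<in> set is" for i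
    using H(2,3) assms(3)[of i] that unfolding quotients_def by fast
  then show "g i = \<one>"
    using generic_onD[OF assms(1) H(1) _ _ H(4,5)] H(2) assms(2) by blast
qed

text \<open>Mixed quotients split at \<open>s\<close> and \<open>u\<close>, as
  \<open>(inv p s)(inv u v)\<close> or \<open>(inv v u)(inv s q)\<close>; within the shifted copy of
  \<open>R\<close> the shift cancels. The order of the factors depends on the case.\<close>

lemma quotients_merge:
  assumes "T \<subseteq> carrier G" "R \<subseteq> carrier G" "s \<in> carrier G" "u \<in> R"
    and z: "z \<in> quotients (T \<union> (\<lambda>v. s \<otimes> inv u \<otimes> v) ` R)"
  obtains x y where "x \<in> insert \<one> (quotients (insert s T))" "y \<in> insert \<one> (quotients R)"
    "z = x \<otimes> y \<or> z = y \<otimes> x"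
proof -
  have u: "u \<in> carrier G" using assms by auto
  consider p q where "p \<in> T" "q \<in> T" "z = inv p \<otimes> q"
    | p v where "p \<in> T" "v \<in> R" "z = inv p \<otimes> (s \<otimes> inv u \<otimes> v)"
    | v q where "v \<in> R" "q \<in> T" "z = inv (s \<otimes> inv u \<otimes> v) \<otimes> q"
    | v w where "v \<in> R" "w \<in> R" "z = inv (s \<otimes> inv u \<otimes> v) \<otimes> (s \<otimes> inv u \<otimes> w)"
    using z unfolding quotients_def by blast
  then show ?thesis
  proof cases
    case 1
    then have "z \<in> quotients (insert s T)" "z \<in> carrier G"
      using assms by (auto simp: quotients_def)
    then show ?thesis by (intro that[of z \<one>]) auto
  next
    case 2
    then have "z = (inv p \<otimes> s) \<otimes> (inv u \<otimes> v)"
      using assms u by (simp add: m_assoc subset_eq)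
    moreover have "inv p \<otimes> s \<in> quotients (insert s T)" "inv u \<otimes> v \<in> quotients R"
      using 2 assms by (auto simp: quotients_def)
    ultimately show ?thesis using that by blast
  next
    case 3
    then have "z = (inv v \<otimes> u) \<otimes> (inv s \<otimes> q)"
      using assms u by (simp add: m_assoc subset_eq inv_mult_group)
    moreover have "inv s \<otimes> q \<in> quotients (insert s T)" "inv v \<otimes> u \<in> quotients R"
      using 3 assms by (auto simp: quotients_def)
    ultimately show ?thesis using that by blast
  next
    case 4
    have vw: "v \<in> carrier G" "w \<in> carrier G" using 4 assms by auto
    have "inv (s \<otimes> inv u \<otimes> v) \<otimes> (s \<otimes> inv u \<otimes> w)
        = inv v \<otimes> (inv (s \<otimes> inv u) \<otimes> (s \<otimes> inv u)) \<otimes> w"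
      using vw assms(3) u by (simp add: m_assoc inv_mult_group del: l_inv r_inv)
    then have "z = inv v \<otimes> w"
      using 4 vw assms(3) u by simp
    then have "z \<in> quotients R" "z \<in> carrier G"
      using 4 vw by (auto simp: quotients_def)
    then show ?thesis by (intro that[of \<one> z]) auto
  qed
qed

text \<open>In a relation for the merged family, the entry at \<open>k\<close> is replaced by two
  entries at \<open>k\<close> and \<open>i\<close>. The index \<open>i\<close> is free, so the
  longer list is distinct and genericity of \<open>S\<close> makes all entries trivial.\<close>

lemma generic_on_merge:
  assumes gen: "generic_on I S" and S: "\<And>j. j \<in> I \<Longrightarrow> S j \<subseteq> carrier G"
    and k: "k \<in> I" and i: "i \<in> I" "i \<noteq> k"
    and s: "S k = insert s T" and u: "u \<in> S i"
  shows "generic_on (I - {i}) (S(k := T \<union> (\<lambda>v. s \<otimes> inv u \<otimes> v) ` S i))"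
    (is "generic_on _ ?S")
  unfolding generic_on_def
proof (intro allI impI ballI, elim conjE)
  fix "is" g j
  assume dist: "distinct is" and sub: "set is \<subseteq> I - {i}"
    and g: "\<forall>j\<in>set is. g j \<in> insert \<one> (quotients (?S j))"
    and prod: "list_mult (map g is) = \<one>" and j: "j \<in> set is"
  have T: "T \<subseteq> carrier G" "s \<in> carrier G" using S[OF k] s by auto
  show "g j = \<one>"
  proof (cases "k \<in> set is")
    case False
    show ?thesis
      by (rule generic_onD[OF gen dist _ _ prod j]) (use sub g False in \<open>auto split: if_splits\<close>)
  next
    case True
    then obtain xs ys where is_eq: "is = xs @ k # ys" by (auto dest: split_list)
    have g': "g l \<in> insert \<one> (quotients (S l))" "l \<in> I" "l \<noteq> i" "l \<noteq> k"
      if "l \<in> set xs \<union> set ys" for l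
      using g sub dist that by (auto simp: is_eq split: if_splits)
    have carr: "g ` set xs \<subseteq> carrier G" "g ` set ys \<subseteq> carrier G"
      using g'(1,2) quotients_subset[OF S] by fastforce+
    obtain x y where xy: "x \<in> insert \<one> (quotients (S k))" "y \<in> insert \<one> (quotients (S i))"
      "g k = x \<otimes> y \<or> g k = y \<otimes> x"
    proof (cases "g k = \<one>")
      case True
      then show ?thesis by (intro that[of \<one> \<one>]) auto
    next
      case False
      then have "g k \<in> quotients (T \<union> (\<lambda>v. s \<otimes> inv u \<otimes> v) ` S i)"
        using g True by auto
      then show ?thesis
        by (rule quotients_merge[OF T(1) S[OF i(1)] T(2) u]) (use that s in auto)
    qed
    have xyc: "x \<in> carrier G" "y \<in> carrier G"
      using xy(1,2) quotients_subset[OF S[OF k]] quotients_subset[OF S[OF i(1)]] by auto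
    define h where "h = g(k := x, i := y)"
    obtain js where js: "js = [k, i] \<or> js = [i, k]" and "g k = list_mult (map h js)"
    proof (cases "g k = x \<otimes> y")
      case True
      then show ?thesis using i(2) xyc by (intro that[of "[k, i]"]) (auto simp: h_def)
    next
      case False
      then show ?thesis using xy(3) i(2) xyc by (intro that[of "[i, k]"]) (auto simp: h_def)
    qed
    have map_h: "map h xs = map g xs" "map h ys = map g ys"
      using g'(3,4) by (auto simp: h_def)
    have hc: "set (map h js) \<subseteq> carrier G"
      using js xyc i(2) by (auto simp: h_def)
    have "list_mult (map h (xs @ js @ ys)) = list_mult (map g is)"
      using carr hc \<open>g k = _\<close> by (simp add: list_mult_append map_h is_eq)
    then have prod': "list_mult (map h (xs @ js @ ys)) = \<one>" using prod by simp
    have "distinct (xs @ js @ ys)" "set (xs @ js @ ys) \<subseteq> I"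
      using dist js i k g'(2,3) by (auto simp: is_eq)
    moreover have "h l \<in> insert \<one> (quotients (S l))" if "l \<in> set (xs @ js @ ys)" for l
      using that g'(1) js xy(1,2) by (auto simp: h_def)
    ultimately have triv: "h l = \<one>" if "l \<in> set (xs @ js @ ys)" for l
      using generic_onD[OF gen _ _ _ prod' that] by blast
    have "h k = \<one>" "h i = \<one>" using triv js by auto
    then have "g k = \<one>" using \<open>g k = list_mult _\<close> js by auto
    moreover have "g j = \<one>" if "j \<noteq> k"
    proof -
      have "j \<in> set (xs @ js @ ys)" "j \<noteq> i" using j that sub by (auto simp: is_eq)
      then show ?thesis using triv[of j] that by (simp add: h_def)
    qed
    ultimately show ?thesis by blast
  qed
qed

text \<open>A common point \<open>t = s (inv u) v\<close> gives the relation
  \<open>(inv t s)(inv u v) = 1\<close> between quotients of \<open>S k\<close> and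
  \<open>S i\<close>; genericity forces \<open>t = s\<close>, which is not in
  \<open>T\<close>.\<close>

lemma generic_on_merge_disjoint:
  assumes gen: "generic_on I S" and S: "\<And>j. j \<in> I \<Longrightarrow> S j \<subseteq> carrier G"
    and k: "k \<in> I" and i: "i \<in> I" "i \<noteq> k"
    and s: "S k = insert s T" "s \<notin> T" and u: "u \<in> S i"
  shows "T \<inter> (\<lambda>v. s \<otimes> inv u \<otimes> v) ` S i = {}"
proof (rule ccontr)
  assume "\<not> ?thesis"
  then obtain v where v: "v \<in> S i" "s \<otimes> inv u \<otimes> v \<in> T" by auto
  let ?t = "s \<otimes> inv u \<otimes> v"
  define h where "h = (\<lambda>j. if j = k then inv ?t \<otimes> s else inv u \<otimes> v)"
  have c: "s \<in> carrier G" "u \<in> carrier G" "v \<in> carrier G" "?t \<in> carrier G"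
    using S[OF k] S[OF i(1)] s u v by auto
  have "list_mult (map h [k, i]) = inv ?t \<otimes> ?t"
    using c i(2) by (simp add: h_def m_assoc del: l_inv r_inv)
  then have "list_mult (map h [k, i]) = \<one>" using c by simp
  moreover have "h j \<in> insert \<one> (quotients (S j))" if "j \<in> set [k, i]" for j
    using that i s u v by (auto simp: h_def quotients_def)
  ultimately have "h k = \<one>"
    by (intro generic_onD[OF gen, of "[k, i]" h k]) (use k i in auto)
  then have "\<one> = inv ?t \<otimes> s" by (simp add: h_def)
  then have "s = ?t" using inv_solve_left[of \<one> ?t s] c by simp
  then show False using v s by simp
qed

subsection \<open>Counting packings\<close>

text \<open>General index sets and empty members are allowed, since the induction deletes indices
  and builds one set up from the empty set.\<close>

definition packings_on :: "'i set \<Rightarrow> ('i \<Rightarrow> 'a set) \<Rightarrow> ('i \<Rightarrow> 'a) set"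
  where "packings_on I S =
    {g \<in> I \<rightarrow>\<^sub>E carrier G. disjoint_family_on (\<lambda>i. (\<otimes>) (g i) ` S i) I}"

lemma l_coset_image: "l_coset G x T = (\<otimes>) x ` T"
  by (auto simp: l_coset_def)

lemma finite_packings_on: "finite I \<Longrightarrow> finite (carrier G) \<Longrightarrow> finite (packings_on I S)"
  by (simp add: packings_on_def finite_PiE)

lemma disjoint_family_on_cong:
  "(\<And>i. i \<in> I \<Longrightarrow> A i = B i) \<Longrightarrow> disjoint_family_on A I \<longleftrightarrow> disjoint_family_on B I"
  by (auto simp: disjoint_family_on_def)

lemma packings_on_insert_empty:
  assumes "k \<notin> J" "S k = {}"
  shows "packings_on (insert k J) S = (\<lambda>(y, g). g(k := y)) ` (carrier G \<times> packings_on J S)"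
proof -
  have *: "disjoint_family_on (\<lambda>i. (\<otimes>) ((g(k := y)) i) ` S i) (insert k J) \<longleftrightarrow>
      disjoint_family_on (\<lambda>i. (\<otimes>) (g i) ` S i) J" for g y
  proof -
    have "disjoint_family_on (\<lambda>i. (\<otimes>) ((g(k := y)) i) ` S i) J \<longleftrightarrow> disjoint_family_on (\<lambda>i. (\<otimes>) (g i) ` S i) J"
      by (rule disjoint_family_on_cong) (use assms in auto)
    then show ?thesis
      by (subst disjoint_family_on_insert) (use assms in \<open>auto\<close>)
  qed
  show ?thesis
    unfolding packings_on_def PiE_insert_eq using * by (auto simp del: fun_upd_apply)
qed

lemma card_packings_on_insert_empty:
  assumes "k \<notin> J" "S k = {}"
  shows "card (packings_on (insert k J) S) = order G * card (packings_on J S)"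
proof -
  have "inj_on (\<lambda>(y, g). g(k := y)) (carrier G \<times> packings_on J S)"
    by (rule inj_on_subset[OF inj_combinator[OF assms(1), of "\<lambda>_. carrier G"]])
      (auto simp: packings_on_def)
  then show ?thesis
    unfolding packings_on_insert_empty[of k J S, OF assms]
    by (simp add: card_image order_def card_cartesian_product)
qed

text \<open>The constraint determines \<open>g i\<close> from \<open>g k\<close> and makes the
  translate of \<open>S i\<close> equal to \<open>g k\<close> times the shifted copy, so
  \<open>i\<close> can be forgotten and later restored.\<close>

lemma bij_betw_packings_on_merge:
  assumes neq: "k \<noteq> i" "k \<notin> J" "i \<notin> J"
    and carr: "T \<subseteq> carrier G" "S i \<subseteq> carrier G" "s \<in> carrier G" "u \<in> carrier G"
    and disj: "T \<inter> (\<lambda>v. s \<otimes> inv u \<otimes> v) ` S i = {}"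
  shows "bij_betw (\<lambda>g. restrict g (insert k J))
    {g \<in> packings_on (insert k (insert i J)) (S(k := T)). g k \<otimes> s = g i \<otimes> u}
    (packings_on (insert k J) (S(k := T \<union> (\<lambda>v. s \<otimes> inv u \<otimes> v) ` S i)))"
    (is "bij_betw ?f ?A ?B")
proof -
  let ?R = "(\<lambda>v. s \<otimes> inv u \<otimes> v) ` S i"
  let ?h = "\<lambda>h. h(i := h k \<otimes> s \<otimes> inv u)"
  have R: "(\<otimes>) (x \<otimes> s \<otimes> inv u) ` S i = (\<otimes>) x ` ?R" if "x \<in> carrier G" for x
    using that carr by (auto simp: image_image m_assoc subset_eq intro!: image_cong)
  have Rc: "?R \<subseteq> carrier G" using carr by auto
  have family: "disjoint_family_on (\<lambda>j. (\<otimes>) (g j) ` (S(k := T)) j) (insert k (insert i J)) \<longleftrightarrow>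
      disjoint_family_on (\<lambda>j. (\<otimes>) (g j) ` (S(k := T \<union> ?R)) j) (insert k J)"
    if g: "g k \<in> carrier G" "g i = g k \<otimes> s \<otimes> inv u" for g
  proof -
    have J: "disjoint_family_on (\<lambda>j. (\<otimes>) (g j) ` (S(k := X)) j) J \<longleftrightarrow>
        disjoint_family_on (\<lambda>j. (\<otimes>) (g j) ` S j) J"
      "(\<Union>j\<in>J. (\<otimes>) (g j) ` (S(k := X)) j) = (\<Union>j\<in>J. (\<otimes>) (g j) ` S j)" for X
      using neq by (auto intro!: disjoint_family_on_cong split: if_splits)
    \<comment> \<open>Disjointness of the translates at \<open>k\<close> and \<open>i\<close>,
      required on the left only, is automatic because left translation is injective.\<close>
    have "inj_on ((\<otimes>) (g k)) (T \<union> ?R)"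
      using g(1) carr(1) Rc by (intro inj_onI) (auto simp: subset_eq)
    then have "((\<otimes>) (g k) ` T) \<inter> ((\<otimes>) (g k) ` ?R) = {}"
      using disj
      by (subst inj_on_image_Int[symmetric, of _ "T \<union> ?R"]) auto
    moreover have "(\<otimes>) (g k) ` (T \<union> ?R) = ((\<otimes>) (g k) ` T) \<union> ((\<otimes>) (g k) ` ?R)"
      by (rule image_Un)
    moreover have "(\<otimes>) (g i) ` S i = (\<otimes>) (g k) ` ?R" using R g by simp
    ultimately show ?thesis
      using neq by (simp add: disjoint_family_on_insert J Int_Un_distrib Int_Un_distrib2 conj_ac
          fun_upd_same fun_upd_other del: fun_upd_apply)
  qed
  have g_i: "g i = g k \<otimes> s \<otimes> inv u" if "g k \<otimes> s = g i \<otimes> u" "g i \<in> carrier G" for g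
    using that carr by (metis inv_solve_right m_closed)
  show ?thesis
  proof (rule bij_betw_byWitness[where f' = ?h])
    show "\<forall>g\<in>?A. ?h (?f g) = g"
    proof
      fix g assume g: "g \<in> ?A"
      then have "g i = g k \<otimes> s \<otimes> inv u" by (intro g_i) (auto simp: packings_on_def)
      moreover have "g \<in> extensional (insert k (insert i J))"
        using g by (auto simp: packings_on_def PiE_def)
      ultimately show "?h (?f g) = g"
        by (auto simp: fun_eq_iff restrict_def extensional_def)
    qed
    show "\<forall>h\<in>?B. ?f (?h h) = h"
      using neq by (auto simp: packings_on_def fun_eq_iff restrict_def PiE_def extensional_def)
    show "?f ` ?A \<subseteq> ?B"
    proof
      fix h assume "h \<in> ?f ` ?A"
      then obtain g where g: "g \<in> ?A" and h: "h = ?f g" by auto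
      have gc: "g j \<in> carrier G" if "j \<in> insert k (insert i J)" for j
        using g that by (auto simp: packings_on_def)
      have "disjoint_family_on (\<lambda>j. (\<otimes>) (g j) ` (S(k := T \<union> ?R)) j) (insert k J)"
        using g family[of g] g_i[of g] gc by (simp add: packings_on_def del: fun_upd_apply)
      then have "disjoint_family_on (\<lambda>j. (\<otimes>) (h j) ` (S(k := T \<union> ?R)) j) (insert k J)"
        by (subst disjoint_family_on_cong[where B = "\<lambda>j. (\<otimes>) (g j) ` (S(k := T \<union> ?R)) j"])
          (simp_all add: h)
      then show "h \<in> ?B" using gc by (simp add: packings_on_def h)
    qed
    show "?h ` ?B \<subseteq> ?A"
    proof
      fix g assume "g \<in> ?h ` ?B"
      then obtain h where h: "h \<in> ?B" and g: "g = ?h h" by auto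
      have hc: "h j \<in> carrier G" if "j \<in> insert k J" for j
        using h that by (auto simp: packings_on_def)
      have gk: "g k = h k" "g i = g k \<otimes> s \<otimes> inv u" using neq by (simp_all add: g)
      have "disjoint_family_on (\<lambda>j. (\<otimes>) (h j) ` (S(k := T \<union> ?R)) j) (insert k J)"
        using h by (simp add: packings_on_def)
      then have "disjoint_family_on (\<lambda>j. (\<otimes>) (g j) ` (S(k := T \<union> ?R)) j) (insert k J)"
        by (subst disjoint_family_on_cong[where B = "\<lambda>j. (\<otimes>) (h j) ` (S(k := T \<union> ?R)) j"])
          (use neq in \<open>auto simp: g\<close>)
      then have "disjoint_family_on (\<lambda>j. (\<otimes>) (g j) ` (S(k := T)) j) (insert k (insert i J))"
        using family[of g] gk hc by simp
      moreover have "g \<in> insert k (insert i J) \<rightarrow>\<^sub>E carrier G"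
        using h hc carr by (auto simp: g packings_on_def PiE_def extensional_def)
      moreover have "g k \<otimes> s = g i \<otimes> u"
        using gk hc carr by (simp add: m_assoc)
      ultimately show "g \<in> ?A" by (simp add: packings_on_def)
    qed
  qed
qed

text \<open>A packing with \<open>T\<close> fails to be one with \<open>S k\<close> exactly when the
  translate of \<open>s\<close> hits another translate. The failures are sorted by the pair
  \<open>(i, u)\<close> that is hit.\<close>

lemma card_packings_on_insert_point:
  assumes fin: "finite (carrier G)" "finite J" and k: "k \<notin> J"
    and gen: "generic_on (insert k J) S" and S: "\<And>j. j \<in> insert k J \<Longrightarrow> S j \<subseteq> carrier G"
    and s: "S k = insert s T" "s \<notin> T"
  shows "card (packings_on (insert k J) (S(k := T))) = card (packings_on (insert k J) S) +
    (\<Sum>i\<in>J. \<Sum>u\<in>S i. card (packings_on (insert k (J - {i}))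
       (S(k := T \<union> (\<lambda>v. s \<otimes> inv u \<otimes> v) ` S i))))"
proof -
  let ?P = "packings_on (insert k J) (S(k := T))"
  define B where "B = (\<lambda>(i, u). {g \<in> ?P. g k \<otimes> s = g i \<otimes> u})"
  have finS: "finite (S i)" if "i \<in> J" for i
    using S[of i] that fin(1) by (auto intro: finite_subset)
  have carr: "T \<subseteq> carrier G" "s \<in> carrier G" using S[of k] s by auto
  have family: "disjoint_family_on (\<lambda>j. (\<otimes>) (g j) ` S j) (insert k J) \<longleftrightarrow>
      disjoint_family_on (\<lambda>j. (\<otimes>) (g j) ` (S(k := T)) j) (insert k J) \<and> (\<forall>i\<in>J. g k \<otimes> s \<notin> (\<otimes>) (g i) ` S i)" for g
  proof -
    have "disjoint_family_on (\<lambda>j. (\<otimes>) (g j) ` (S(k := T)) j) J \<longleftrightarrow>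
        disjoint_family_on (\<lambda>j. (\<otimes>) (g j) ` S j) J"
      "(\<Union>j\<in>J. (\<otimes>) (g j) ` (S(k := T)) j) = (\<Union>j\<in>J. (\<otimes>) (g j) ` S j)"
      using k by (auto intro!: disjoint_family_on_cong split: if_splits)
    then show ?thesis
      using k s by (simp add: disjoint_family_on_insert del: fun_upd_apply)
        (auto)
  qed
  have "?P = packings_on (insert k J) S \<union> (\<Union>p\<in>Sigma J S. B p)"
    using family by (auto simp: packings_on_def B_def simp del: fun_upd_apply)
  moreover have "packings_on (insert k J) S \<inter> (\<Union>p\<in>Sigma J S. B p) = {}"
    using family by (auto simp: packings_on_def B_def simp del: fun_upd_apply)
  moreover have finP: "finite ?P" "finite (packings_on (insert k J) S)"
    using fin by (auto intro: finite_packings_on)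
  moreover have finB: "finite (B p)" for p
    using finP(1) by (auto simp: B_def split: prod.split)
  moreover have finSig: "finite (Sigma J S)" using fin finS by auto
  ultimately have "card ?P = card (packings_on (insert k J) S) + card (\<Union>p\<in>Sigma J S. B p)"
    by (simp add: card_Un_disjoint)
  also have "card (\<Union>p\<in>Sigma J S. B p) = (\<Sum>p\<in>Sigma J S. card (B p))"
  proof (rule card_UN_disjoint)
    show "\<forall>p\<in>Sigma J S. \<forall>q\<in>Sigma J S. p \<noteq> q \<longrightarrow> B p \<inter> B q = {}"
    proof (intro ballI impI, rule ccontr)
      fix p q assume pq: "p \<in> Sigma J S" "q \<in> Sigma J S" "p \<noteq> q" "B p \<inter> B q \<noteq> {}"
      obtain i u i' u' where eq: "p = (i, u)" "q = (i', u')" by (cases p, cases q)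
      from pq(4) obtain g where "g \<in> B p" "g \<in> B q" by blast
      then have g: "g \<in> ?P" "g i \<otimes> u = g i' \<otimes> u'"
        by (simp_all add: B_def eq)
      have mem: "i \<in> J" "i' \<in> J" "u \<in> S i" "u' \<in> S i'" using pq eq by auto
      \<comment> \<open>The same point lies in both translates, so \<open>i = i'\<close>, and
        cancellation then gives \<open>u = u'\<close>.\<close>
      have "g i \<otimes> u \<in> ((\<otimes>) (g i) ` (S(k := T)) i) \<inter> ((\<otimes>) (g i') ` (S(k := T)) i')"
      proof
        have "i \<noteq> k" "i' \<noteq> k" using mem k by auto
        then show "g i \<otimes> u \<in> (\<otimes>) (g i) ` (S(k := T)) i" "g i \<otimes> u \<in> (\<otimes>) (g i') ` (S(k := T)) i'"
          using mem by (simp, simp add: g(2))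
      qed
      then have "i = i'"
        using g(1) mem unfolding packings_on_def disjoint_family_on_def by blast
      moreover have "g i \<in> carrier G" using g(1) mem by (auto simp: packings_on_def)
      moreover have "u \<in> carrier G" "u' \<in> carrier G" using S mem by auto
      ultimately have "u = u'" using g(2) by simp
      with \<open>i = i'\<close> show False using pq(3) eq by simp
    qed
  qed (use finB finSig in auto)
  also have "\<dots> = (\<Sum>i\<in>J. \<Sum>u\<in>S i. card (B (i, u)))"
    using fin finS by (subst sum.Sigma) auto
  also have "\<dots> = (\<Sum>i\<in>J. \<Sum>u\<in>S i. card (packings_on (insert k (J - {i}))
       (S(k := T \<union> (\<lambda>v. s \<otimes> inv u \<otimes> v) ` S i))))"
  proof (intro sum.cong refl)
    fix i u assume iu: "i \<in> J" "u \<in> S i"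
    have ik: "k \<noteq> i" using iu k by auto
    have "T \<inter> (\<lambda>v. s \<otimes> inv u \<otimes> v) ` S i = {}"
      using generic_on_merge_disjoint[OF gen S _ _ _ s iu(2)] iu ik by simp
    then have "bij_betw (\<lambda>g. restrict g (insert k (J - {i})))
      {g \<in> packings_on (insert k (insert i (J - {i}))) (S(k := T)). g k \<otimes> s = g i \<otimes> u}
      (packings_on (insert k (J - {i})) (S(k := T \<union> (\<lambda>v. s \<otimes> inv u \<otimes> v) ` S i)))"
      using carr S iu ik k by (intro bij_betw_packings_on_merge) auto
    then show "card (B (i, u)) = card (packings_on (insert k (J - {i}))
       (S(k := T \<union> (\<lambda>v. s \<otimes> inv u \<otimes> v) ` S i)))"
      using iu(1) by (simp add: B_def insert_absorb bij_betw_same_card)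
  qed
  finally show ?thesis .
qed

end

section \<open>Identification of the number of packings with \<open>U_value\<close>\<close>

theorem (in group) card_packings_on:
  assumes fin: "finite (carrier G)" and "finite I" and "generic_on I S"
    and "\<And>i. i \<in> I \<Longrightarrow> S i \<subseteq> carrier G"
  shows "real (card (packings_on I S)) =
    U_value (real (order G)) (card I) (esym (\<lambda>i. real (card (S i))) I)"
  using assms(2-)
\<comment> \<open>\<open>S\<close> must vary because the smaller families are merged ones, not just
  subfamilies.\<close>
proof (induction "card I" arbitrary: I S)
  case 0
  then have "I = {}" by simp
  then show ?case
    by (simp add: packings_on_def disjoint_family_on_def U_value_def U_coeff_def)
next
  case (Suc n)
  obtain k J where I: "I = insert k J" "k \<notin> J" "card J = n"
    using Suc.hyps(2) by (metis card_Suc_eq)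
  have J: "finite J" using Suc.prems I by simp
  define a where "a i = real (card (S i))" for i
  define N where "N = real (order G)"
  have carr: "S i \<subseteq> carrier G" if "i \<in> insert k J" for i
    using Suc.prems that I by blast
  have finS: "finite (S i)" if "i \<in> insert k J" for i
    using carr[OF that] fin by (rule finite_subset)
  \<comment> \<open>Inner induction: the set at \<open>k\<close> grows from empty to
    \<open>S k\<close>, one point at a time.\<close>
  have "real (card (packings_on I (S(k := T)))) = U_value N (Suc n) (esym (a(k := real (card T))) I)"
    if "finite T" "T \<subseteq> S k" for T
    using that
  proof (induction T rule: finite_induct)
    case empty
    have "packings_on J (S(k := {})) = packings_on J S"
      unfolding packings_on_def using I(2)
      by (intro Collect_cong conj_cong refl disjoint_family_on_cong) auto
    then have "real (card (packings_on I (S(k := {})))) = N * real (card (packings_on J S))"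
      using card_packings_on_insert_empty[OF I(2), of "S(k := {})"] by (simp add: I N_def)
    also have "real (card (packings_on J S)) = U_value N n (esym a J)"
      using Suc.hyps(1)[of J S] I J Suc.prems generic_on_mono[OF Suc.prems(2), of J S]
      by (auto simp: N_def a_def[abs_def])
    \<comment> \<open>\<open>J\<close> has \<open>n\<close> elements, so its symmetric functions
      vanish beyond \<open>n\<close>.\<close>
    also have "N * \<dots> = U_value N (Suc n) (esym a J)"
      using I J by (intro U_value_Suc[symmetric] esym_eq_0) auto
    also have "esym a J = esym (a(k := 0)) I"
    proof
      fix j show "esym a J j = esym (a(k := 0)) I j"
        by (cases j) (simp_all add: I J esym_insert_upd)
    qed
    finally show ?case by (simp del: fun_upd_apply)
  next
    case (insert s T)
    define S' where "S' = S(k := insert s T)"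
    define M where "M i u = S'(k := T \<union> (\<lambda>v. s \<otimes> inv u \<otimes> v) ` S' i)" for i u
    have S': "S' k = insert s T" "S'(k := T) = S(k := T)" "\<And>i. i \<in> J \<Longrightarrow> S' i = S i"
      using I by (auto simp: S'_def)
    have carr': "S' i \<subseteq> carrier G" if "i \<in> insert k J" for i
      using carr[OF that] insert.prems by (cases "i = k") (simp_all add: S'_def, blast)
    have gen': "generic_on (insert k J) S'"
      by (rule generic_on_mono[OF Suc.prems(2)]) (use I insert.prems in \<open>auto simp: S'_def\<close>)
    have M: "real (card (packings_on (insert k (J - {i})) (M i u))) =
        U_value N n (esym (a(k := real (card T) + a i)) (insert k (J - {i})))"
      if i: "i \<in> J" and u: "u \<in> S i" for i u
    proof -
      have ik: "i \<noteq> k" using I i by auto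
      have c: "s \<in> carrier G" "u \<in> carrier G" "T \<subseteq> carrier G" "S i \<subseteq> carrier G"
        using carr'[of k] carr[of i] i u S'(1) by auto
      have J_eq: "insert k J - {i} = insert k (J - {i})" using ik by auto
      have gen: "generic_on (insert k (J - {i})) (M i u)"
        using generic_on_merge[OF gen' carr' _ _ ik S'(1)] i u S'(3)[OF i]
        by (simp add: M_def J_eq)
      have "(\<lambda>v. s \<otimes> inv u \<otimes> v) ` S i \<subseteq> carrier G"
        using c by auto
      then have Mc: "M i u j \<subseteq> carrier G" if "j \<in> insert k (J - {i})" for j
        using that carr'[of j] c S' i by (auto simp: M_def)
      have "inj_on (\<lambda>v. s \<otimes> inv u \<otimes> v) (S i)"
        using c by (intro inj_onI) (auto simp: subset_eq)
      moreover have "T \<inter> (\<lambda>v. s \<otimes> inv u \<otimes> v) ` S i = {}"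
        using generic_on_merge_disjoint[OF gen' carr' _ _ ik S'(1) insert.hyps(2)] i u S'(3)[OF i]
        by simp
      ultimately have "card (M i u k) = card T + card (S i)"
        using insert.hyps finS i S'(3)[OF i] by (simp add: M_def card_Un_disjoint card_image)
      then have "real (card (M i u j)) = (a(k := real (card T) + a i)) j" if "j \<in> insert k (J - {i})" for j
        using that S' by (auto simp: M_def a_def)
      then have "esym (\<lambda>j. real (card (M i u j))) (insert k (J - {i})) =
          esym (a(k := real (card T) + a i)) (insert k (J - {i}))"
        by (rule esym_cong)
      moreover have "card (insert k (J - {i})) = n"
        using I J i card_Suc_Diff1[of J i] by simp
      ultimately show ?thesis
        using Suc.hyps(1)[of "insert k (J - {i})" "M i u"] J gen Mc by (simp add: N_def)
    qed
    have "card (packings_on I (S(k := T))) = card (packings_on I S') +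
        (\<Sum>i\<in>J. \<Sum>u\<in>S' i. card (packings_on (insert k (J - {i})) (M i u)))"
      using card_packings_on_insert_point[OF fin J I(2) gen' carr' S'(1) insert.hyps(2)]
      by (simp add: S'(2) M_def I)
    then have "real (card (packings_on I S')) = real (card (packings_on I (S(k := T)))) -
        (\<Sum>i\<in>J. \<Sum>u\<in>S' i. real (card (packings_on (insert k (J - {i})) (M i u))))"
      by simp
    \<comment> \<open>By \<open>M\<close> the summand does not depend on \<open>u\<close>, so the
      inner sum contributes the factor \<open>a i\<close>.\<close>
    also have "(\<Sum>i\<in>J. \<Sum>u\<in>S' i. real (card (packings_on (insert k (J - {i})) (M i u)))) =
       (\<Sum>i\<in>J. a i * U_value N n (esym (a(k := real (card T) + a i)) (insert k (J - {i}))))"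
      using S'(3) M by (simp add: a_def[symmetric])
    also have "real (card (packings_on I (S(k := T)))) = U_value N (Suc n) (esym (a(k := real (card T))) I)"
      using insert.IH insert.prems by (simp del: fun_upd_apply)
    finally show ?case
      using U_value_esym_rec[OF J I(2), of N n a "real (card T)"] insert.hyps
      by (simp add: S'_def I add.commute del: fun_upd_apply)
  qed
  from this[of "S k"] have "real (card (packings_on I S)) = U_value N (Suc n) (esym a I)"
    using finS I by (simp add: a_def[of k, symmetric])
  then show ?case
    using Suc.hyps(2) by (simp add: N_def a_def[abs_def])
qed

section \<open>Translation to the series \<open>U\<close> and to a polynomial in the group
  order\<close>

theorem theorem2p1:
  fixes G :: "('a, 'b) monoid_scheme" and n :: nat and S :: "nat \<Rightarrow> 'a set"
    and \<sigma> :: "nat \<Rightarrow> real"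
  assumes "group G" and "finite (carrier G)"
    and "\<And>i. i \<in> {1..n} \<Longrightarrow> S i \<subseteq> carrier G \<and> S i \<noteq> {}"
    and "generic_family G n S"
    and "\<sigma> = size_sigma n S"
  shows "finite {m. fps_nth (U_specialized \<sigma>) m \<noteq> 0}
    \<and> real (card (packings G n S))
        = real (order G) ^ n * eval_fps (U_specialized \<sigma>) (inverse (real (order G)))
    \<and> (\<exists>P :: real poly. degree P = n
        \<and> (\<forall>x. x \<noteq> 0 \<longrightarrow> poly P x = x ^ n * eval_fps (U_specialized \<sigma>) (inverse x)))"
proof -
  interpret group G by fact
  have \<sigma>: "\<sigma> = esym (\<lambda>i. real (card (S i))) {1..n}"
    using assms(5) by (simp add: size_sigma_def esym_def fun_eq_iff)
  \<comment> \<open>Symmetric functions of \<open>n\<close> numbers vanish beyond index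
    \<open>n\<close>; this gives the finite support and the finite evaluation.\<close>
  have zero: "U_coeff \<sigma> m = 0" if "m > n" for m
    using that unfolding \<sigma> by (intro U_coeff_eq_0 esym_eq_0) auto
  have eval: "x ^ n * eval_fps (U_specialized \<sigma>) (inverse x) = U_value x n \<sigma>" if "x \<noteq> 0" for x
  proof -
    have "eval_fps (U_specialized \<sigma>) (inverse x) = (\<Sum>m\<le>n. U_coeff \<sigma> m * inverse x ^ m)"
      unfolding eval_fps_def fps_nth_U_specialized
      by (rule suminf_finite) (auto simp: zero)
    also have "x ^ n * \<dots> = U_value x n \<sigma>"
      unfolding U_value_def sum_distrib_left using that
      by (intro sum.cong refl) (simp add: power_diff field_simps)
    finally show ?thesis .
  qed
  define P where "P = (\<Sum>m\<le>n. monom (U_coeff \<sigma> m) (n - m))"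
  \<comment> \<open>Only \<open>m = 0\<close> reaches degree \<open>n\<close>, with coefficient 1,
    so the degree is exactly \<open>n\<close>.\<close>
  have "poly.coeff P n = (\<Sum>m\<le>n. if m = 0 then 1 else 0)"
    unfolding P_def coeff_sum by (intro sum.cong refl) (auto simp: U_coeff_def)
  moreover have "degree P \<le> n"
    unfolding P_def by (intro degree_sum_le) (auto intro: order.trans[OF degree_monom_le])
  ultimately have "degree P = n"
    by (intro antisym le_degree) simp_all
  moreover have "poly P x = U_value x n \<sigma>" for x
    by (simp add: P_def U_value_def poly_sum poly_monom mult.commute)
  moreover have "finite {m. fps_nth (U_specialized \<sigma>) m \<noteq> 0}"
    by (rule finite_subset[of _ "{..n}"])
      (use zero in \<open>auto simp: fps_nth_U_specialized intro: leI\<close>)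
  moreover have "real (card (packings G n S)) = U_value (real (order G)) n \<sigma>"
  proof -
    have "packings G n S = packings_on {1..n} S"
      by (simp add: packings_def packings_on_def l_coset_image)
    then show ?thesis
      using card_packings_on[OF assms(2), of "{1..n}" S]
        generic_family_imp_generic_on[OF assms(4)] assms(3) \<sigma> by simp
  qed
  moreover have "real (order G) \<noteq> 0"
    using assms(2) one_closed by (auto simp: order_def)
  ultimately show ?thesis
    using eval by auto
qed

end
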